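(* Every weak bar $1$-visibility graph is quasi-planar.
   Context: A bar layout is a finite set of pairwise non-intersecting horizontal line segments (bars). Two bars $u,v$ are $1$-visible if there is an axis-aligned rectangle of non-zero width whose bottom side lies on one of the two bars and whose top side lies on the other, and which intersects at most one other bar. The strong bar $1$-visibility graph of a layout has a vertex for each bar and an edge $uv$ exactly when $u,v$ are $1$-visible; a weak bar $1$-visibility graph of a layout is any spanning subgraph of it. A graph is a weak bar $1$-visibility graph if it is (isomorphic to) a weak bar $1$-visibility graph of some bar layout. A topological drawing of a graph maps vertices to distinct points and each edge $uv$ to a Jordan arc joining the points of $u$ and $v$ passing through no other vertex point, such that any two edges share at most one point. A graph is quasi-planar if it admits a topological drawing in which no three edges pairwise cross. *)

theory Defs
  imports "HOL-Analysis.Analysis"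
begin

definition simple_graph :: "'a set \<Rightarrow> 'a set set \<Rightarrow> bool" where
  "simple_graph V E \<longleftrightarrow> finite V \<and> (\<forall>e\<in>E. e \<subseteq> V \<and> card e = 2)"

definition graph_isomorphic :: "'a set \<Rightarrow> 'a set set \<Rightarrow> 'b set \<Rightarrow> 'b set set \<Rightarrow> bool" where
  "graph_isomorphic V E W F \<longleftrightarrow> (\<exists>f. bij_betw f V W \<and> F = (\<lambda>e. f ` e) ` E)"

section \<open>Bar layouts and 1-visibility\<close>

text \<open>Bars are closed, non-degenerate segments, represented by their point sets.\<close>

definition bar :: "(real \<times> real) set \<Rightarrow> bool" where
  "bar S \<longleftrightarrow> (\<exists>a b y. a < b \<and> S = closed_segment (a, y) (b, y))"

definition bar_layout :: "(real \<times> real) set set \<Rightarrow> bool" where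
  "bar_layout B \<longleftrightarrow> finite B \<and> (\<forall>S\<in>B. bar S) \<and> pairwise disjnt B"

definition one_visible ::
  "(real \<times> real) set set \<Rightarrow> (real \<times> real) set \<Rightarrow> (real \<times> real) set \<Rightarrow> bool" where
  "one_visible B u v \<longleftrightarrow>
     (\<exists>a b c d. a < b \<and> c < d \<and>
        ({a..b} \<times> {c} \<subseteq> u \<and> {a..b} \<times> {d} \<subseteq> v \<or>
         {a..b} \<times> {c} \<subseteq> v \<and> {a..b} \<times> {d} \<subseteq> u) \<and>
        card {w \<in> B - {u, v}. w \<inter> ({a..b} \<times> {c..d}) \<noteq> {}} \<le> 1)"

text \<open>The vertex set of the strong and of every weak graph of a layout is the layout itself.\<close>

definition strong_bar1_edges :: "(real \<times> real) set set \<Rightarrow> (real \<times> real) set set set" where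
  "strong_bar1_edges B = {{u, v} | u v. u \<in> B \<and> v \<in> B \<and> u \<noteq> v \<and> one_visible B u v}"

definition weak_bar1_visibility_graph :: "'a set \<Rightarrow> 'a set set \<Rightarrow> bool" where
  "weak_bar1_visibility_graph V E \<longleftrightarrow>
     (\<exists>B F. bar_layout B \<and> F \<subseteq> strong_bar1_edges B \<and> graph_isomorphic V E B F)"

section \<open>Topological drawings and quasi-planarity\<close>

definition topological_drawing ::
  "'a set \<Rightarrow> 'a set set \<Rightarrow> ('a \<Rightarrow> real \<times> real) \<Rightarrow> ('a set \<Rightarrow> real \<Rightarrow> real \<times> real) \<Rightarrow> bool" where
  "topological_drawing V E p \<gamma> \<longleftrightarrow>
     inj_on p V \<and>
     (\<forall>e\<in>E. arc (\<gamma> e) \<and> {pathstart (\<gamma> e), pathfinish (\<gamma> e)} = p ` e \<and>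
             path_image (\<gamma> e) \<inter> p ` (V - e) = {}) \<and>
     (\<forall>e\<in>E. \<forall>f\<in>E. e \<noteq> f \<longrightarrow> (\<exists>z. path_image (\<gamma> e) \<inter> path_image (\<gamma> f) \<subseteq> {z}))"

text \<open>
  Two edges cross when they have a common point that is an end point of neither. No
  transversality is required, so a touching of two arcs counts as a crossing as well.
\<close>

definition edges_cross ::
  "('a \<Rightarrow> real \<times> real) \<Rightarrow> ('a set \<Rightarrow> real \<Rightarrow> real \<times> real) \<Rightarrow> 'a set \<Rightarrow> 'a set \<Rightarrow> bool" where
  "edges_cross p \<gamma> e f \<longleftrightarrow>
     (path_image (\<gamma> e) - p ` e) \<inter> (path_image (\<gamma> f) - p ` f) \<noteq> {}"

definition quasi_planar :: "'a set \<Rightarrow> 'a set set \<Rightarrow> bool" where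
  "quasi_planar V E \<longleftrightarrow>
     (\<exists>p \<gamma>. topological_drawing V E p \<gamma> \<and>
        \<not> (\<exists>e\<in>E. \<exists>f\<in>E. \<exists>g\<in>E. e \<noteq> f \<and> f \<noteq> g \<and> e \<noteq> g \<and>
             edges_cross p \<gamma> e f \<and> edges_cross p \<gamma> f g \<and> edges_cross p \<gamma> e g))"

end

theory Submission
  imports Defs
begin

text \<open>
  The vertex of a bar is placed at its left end, and an edge leaves its two vertices
  inside thin bands around their bars and is vertical elsewhere. Two such edges meet away from a
  common vertex only if one of them, say \<open>e\<close>, passes the bar of an end vertex of the other,
  say \<open>f\<close>, and then \<open>e\<close> is to the left of \<open>f\<close>. Every edge is drawn as far to
  the left as possible, which keeps adjacent edges from crossing. Among three pairwise crossing
  edges the leftmost one would cross the other two at the single bar it passes; these two would then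
  be adjacent, a contradiction.
\<close>

text \<open>
  With bars taken half-open, what is visible at \<open>x\<close> depends only on the last bar end at or
  before \<open>x\<close>, so the leftmost position of an edge is attained at a bar end.
\<close>

definition passed ::
  "'a set \<Rightarrow> ('a \<Rightarrow> nat) \<Rightarrow> ('a \<Rightarrow> real) \<Rightarrow> ('a \<Rightarrow> real) \<Rightarrow> 'a set \<Rightarrow> real \<Rightarrow> 'a set" where
  "passed V h l r e x =
     {w \<in> V. (\<exists>u\<in>e. h u < h w) \<and> (\<exists>v\<in>e. h w < h v) \<and> l w \<le> x \<and> x < r w}"

section \<open>Drawing the edges over bars whose heights are distinct integers\<close>

definition tent :: "real \<Rightarrow> real" where
  "tent s = max 0 (1 - 2 * \<bar>s\<bar>)"

lemma tent_eq_0: "\<bar>s\<bar> \<ge> 1/2 \<Longrightarrow> tent s = 0"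
  by (auto simp: tent_def)

lemma tent_pos: "\<bar>s\<bar> < 1/2 \<Longrightarrow> tent s > 0"
  by (auto simp: tent_def)

lemma tent_le_1: "tent s \<le> 1"
  by (auto simp: tent_def)

lemma tent_eq_1_iff: "tent s = 1 \<longleftrightarrow> s = 0"
  by (auto simp: tent_def max_def)

lemma tent_inj_nonneg: "tent s = tent t \<Longrightarrow> tent s > 0 \<Longrightarrow> 0 \<le> s \<Longrightarrow> 0 \<le> t \<Longrightarrow> s = t"
  by (auto simp: tent_def max_def split: if_splits)

lemma tent_inj_nonpos: "tent s = tent t \<Longrightarrow> tent s > 0 \<Longrightarrow> s \<le> 0 \<Longrightarrow> t \<le> 0 \<Longrightarrow> s = t"
  by (auto simp: tent_def max_def split: if_splits)

text \<open>Integer ranks \<open>h\<close> stand for the heights of the bars, and \<open>x e\<close>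
  is the abscissa of the vertical part of \<open>e\<close>. \<open>passed_unique\<close> is what is
  kept of 1-visibility, \<open>x_generic\<close> keeps a curve off the vertices that do not belong
  to its edge, and \<open>passed_adjacent\<close> is the only trace of drawing edges as far left as
  possible.\<close>

locale ranked_layout =
  fixes V :: "'a set" and E :: "'a set set" and h :: "'a \<Rightarrow> nat" and l r :: "'a \<Rightarrow> real"
    and x :: "'a set \<Rightarrow> real"
  assumes edge: "e \<in> E \<Longrightarrow> e \<subseteq> V \<and> card e = 2"
    and inj_h: "inj_on h V"
    and inj_x: "inj_on x E"
    and x_inside: "e \<in> E \<Longrightarrow> w \<in> e \<Longrightarrow> l w < x e \<and> x e < r w"
    and x_generic: "e \<in> E \<Longrightarrow> w \<in> V \<Longrightarrow> x e \<noteq> l w"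
    and passed_unique: "e \<in> E \<Longrightarrow> w \<in> passed V h l r e (x e) \<Longrightarrow>
          w' \<in> passed V h l r e (x e) \<Longrightarrow> w = w'"
    and passed_adjacent: "e \<in> E \<Longrightarrow> f \<in> E \<Longrightarrow> w \<in> passed V h l r e (x e) \<Longrightarrow> u \<in> e \<Longrightarrow>
          f = {u, w} \<Longrightarrow> x f < x e"
begin

lemma edgeE:
  assumes "e \<in> E"
  obtains u v where "e = {u, v}" "u \<in> V" "v \<in> V" "h u < h v"
proof -
  obtain a b where ab: "e = {a, b}" "a \<noteq> b"
    using edge[OF assms] by (auto simp: card_2_iff)
  then have "a \<in> V" "b \<in> V" using edge[OF assms] by auto
  then have "h a \<noteq> h b" using inj_h ab by (auto dest: inj_onD)
  then show thesis using that[of a b] that[of b a] ab \<open>a \<in> V\<close> \<open>b \<in> V\<close>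
    by (metis insert_commute linorder_neqE_nat)
qed

text \<open>Within distance 1/2 of the rank of an end \<open>w\<close>, this is the weighted mean of
  \<open>x e\<close> and \<open>l w\<close> with weight \<open>tent\<close>; elsewhere it is
  \<open>x e\<close>. The weight depends on the height alone, so edges sharing \<open>w\<close>
  approach its left end in the same proportion and meet only there.\<close>

definition abscissa :: "'a set \<Rightarrow> real \<Rightarrow> real" where
  "abscissa e y = x e - (\<Sum>w\<in>e. (x e - l w) * tent (y - h w))"

text \<open>Edges are unordered; \<open>Min\<close> and \<open>Max\<close> direct the curve
  upwards.\<close>

definition height :: "'a set \<Rightarrow> real \<Rightarrow> real" where
  "height e t = (1 - t) * Min (h ` e) + t * Max (h ` e)"

definition point :: "'a \<Rightarrow> real \<times> real" where
  "point w = (l w, h w)"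

definition curve :: "'a set \<Rightarrow> real \<Rightarrow> real \<times> real" where
  "curve e t = (abscissa e (height e t), height e t)"

lemma height_dist:
  fixes y :: real
  assumes "w \<in> V" "w' \<in> V" "w \<noteq> w'" "\<bar>y - h w\<bar> < 1/2"
  shows "\<bar>y - h w'\<bar> \<ge> 1/2"
proof -
  have "h w \<noteq> h w'" using assms inj_h by (auto dest: inj_onD)
  then have "\<bar>real (h w) - real (h w')\<bar> \<ge> 1" by linarith
  then show ?thesis using assms(4) by linarith
qed

text \<open>Ranks are distinct integers, so the bands of half-width 1/2 are disjoint and at most one
  summand survives.\<close>

lemma abscissa_near:
  fixes y :: real
  assumes "e \<in> E" "w \<in> V" "\<bar>y - h w\<bar> < 1/2"
  shows "abscissa e y = (if w \<in> e then x e - (x e - l w) * tent (y - h w) else x e)"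
proof -
  have fin: "finite e" using edge[OF assms(1)] by (auto intro: card_ge_0_finite)
  have "(x e - l w') * tent (y - h w') = (if w' = w then (x e - l w) * tent (y - h w) else 0)"
    if "w' \<in> e" for w'
    using height_dist[of w w' y] assms that edge[OF assms(1)] by (auto simp: tent_eq_0)
  then have "(\<Sum>w'\<in>e. (x e - l w') * tent (y - h w')) =
      (\<Sum>w'\<in>e. if w' = w then (x e - l w) * tent (y - h w) else 0)"
    by (intro sum.cong) auto
  then show ?thesis
    unfolding abscissa_def by (simp add: fin)
qed

lemma abscissa_far:
  fixes y :: real
  assumes "e \<in> E" "\<And>w. w \<in> V \<Longrightarrow> \<bar>y - h w\<bar> \<ge> 1/2"
  shows "abscissa e y = x e"
proof -
  have "(x e - l w) * tent (y - h w) = 0" if "w \<in> e" for w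
    using assms edge[OF assms(1)] that by (auto simp: tent_eq_0)
  then show ?thesis unfolding abscissa_def by (simp add: sum.neutral del: mult_eq_0_iff)
qed

lemma continuous_curve: "continuous_on A (curve e)"
  unfolding curve_def abscissa_def height_def tent_def by (intro continuous_intros)

lemma height_endpoints:
  assumes "e = {u, v}" "h u < h v"
  shows "height e t = (1 - t) * h u + t * h v"
  using assms by (auto simp: height_def)

text \<open>The second coordinate is strictly increasing in the parameter, which gives
  injectivity.\<close>

lemma arc_curve:
  assumes "e \<in> E"
  shows "arc (curve e)"
proof -
  obtain u v where uv: "e = {u, v}" "h u < h v" using edgeE[OF assms] by metis
  have "height e t = h u + t * (real (h v) - h u)" for t
    by (simp add: height_endpoints[OF uv] algebra_simps)
  then have "inj (height e)" using uv(2) by (simp add: inj_on_def)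
  then show ?thesis
    using continuous_curve by (auto simp: arc_def path_def inj_on_def curve_def)
qed

lemma path_image_curve:
  assumes "e = {u, v}" "h u < h v"
  shows "path_image (curve e) = {(abscissa e y, y) | y :: real. h u \<le> y \<and> y \<le> h v}"
proof -
  have "height e ` {0..1} = closed_segment (real (h u)) (h v)"
    by (auto simp: closed_segment_def height_endpoints[OF assms] image_iff)
  also have "\<dots> = {real (h u)..h v}"
    using assms by (simp add: closed_segment_eq_real_ivl)
  finally have "height e ` {0..1} = {real (h u)..h v}" .
  moreover have "path_image (curve e) = (\<lambda>y. (abscissa e y, y)) ` height e ` {0..1}"
    by (auto simp: path_image_def curve_def image_iff)
  ultimately show ?thesis by auto
qed

lemma abscissa_vertex:
  assumes "e \<in> E" "w \<in> e"
  shows "abscissa e (h w) = l w"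
  using abscissa_near[of e w "h w"] assms edge[OF assms(1)] by (auto simp: tent_def)

lemma endpoints_curve:
  assumes "e \<in> E"
  shows "{pathstart (curve e), pathfinish (curve e)} = point ` e"
proof -
  obtain u v where uv: "e = {u, v}" "h u < h v" using edgeE[OF assms] by metis
  have "height e 0 = h u" "height e 1 = h v" by (simp_all add: height_endpoints[OF uv])
  moreover have "abscissa e (h u) = l u" "abscissa e (h v) = l v"
    using abscissa_vertex[OF assms] uv(1) by blast+
  ultimately have "pathstart (curve e) = point u" "pathfinish (curve e) = point v"
    by (simp_all add: pathstart_def pathfinish_def curve_def point_def)
  then show ?thesis using uv(1) by simp
qed

text \<open>At the rank of a bar that is not an end of \<open>e\<close> the curve is vertical, and
  \<open>x_generic\<close> separates \<open>x e\<close> from the left end of that bar.\<close>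

lemma curve_avoids:
  assumes "e \<in> E" "w \<in> V" "w \<notin> e"
  shows "point w \<notin> path_image (curve e)"
proof -
  obtain u v where uv: "e = {u, v}" "h u < h v" using edgeE[OF assms(1)] by metis
  have "abscissa e (h w) = x e"
    using abscissa_near[of e w "h w"] assms by simp
  then show ?thesis
    using x_generic[OF assms(1,2)] by (auto simp: path_image_curve[OF uv] point_def)
qed

section \<open>Common points of two curves\<close>

definition crosses_at :: "'a set \<Rightarrow> 'a set \<Rightarrow> 'a \<Rightarrow> real \<times> real \<Rightarrow> bool" where
  "crosses_at e f w z \<longleftrightarrow> w \<in> passed V h l r e (x e) \<and> w \<in> f \<and> w \<notin> e \<and> x e < x f \<and>
     z \<in> path_image (curve f) \<and> \<bar>snd z - h w\<bar> < 1/2 \<and> fst z = x e"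

text \<open>In the band of \<open>w\<close> the curve of \<open>e\<close> is vertical while that of
  \<open>f\<close> runs between \<open>l w\<close> and \<open>x f\<close>. A common point there puts
  \<open>x e\<close> over the bar of \<open>w\<close> and to the left of \<open>x f\<close>.\<close>

lemma near_bar_crosses_at:
  fixes z :: "real \<times> real"
  assumes "e \<in> E" "f \<in> E" "w \<in> f" "w \<notin> e" "\<bar>snd z - h w\<bar> < 1/2"
    and z: "z \<in> path_image (curve e)" "z \<in> path_image (curve f)"
  shows "crosses_at e f w z"
proof -
  obtain u v where uv: "e = {u, v}" "h u < h v" "u \<in> V" "v \<in> V"
    using edgeE[OF assms(1)] by metis
  obtain u' v' where uv': "f = {u', v'}" "h u' < h v'"
    using edgeE[OF assms(2)] by metis
  have wV: "w \<in> V" using assms edge by blast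
  have ze: "fst z = abscissa e (snd z)" "h u \<le> snd z" "snd z \<le> h v"
    using z by (auto simp: path_image_curve[OF uv(1,2)])
  have zf: "fst z = abscissa f (snd z)"
    using z by (auto simp: path_image_curve[OF uv'])
  have e1: "fst z = x e" using ze(1) abscissa_near[OF assms(1) wV assms(5)] assms by simp
  have f1: "fst z = x f - (x f - l w) * tent (snd z - h w)"
    using zf abscissa_near[OF assms(2) wV assms(5)] assms by simp
  have "x f > l w" "x f < r w" using x_inside assms by auto
  moreover have "(x f - l w) * tent (snd z - h w) > 0"
    using tent_pos[OF assms(5)] \<open>x f > l w\<close> by simp
  moreover have "(x f - l w) * tent (snd z - h w) \<le> (x f - l w)"
    using tent_le_1 \<open>x f > l w\<close> by (simp add: mult_left_le)
  ultimately have "x e < x f" "l w \<le> x e" "x e < r w" using e1 f1 by linarith+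
  \<comment> \<open>The point \<open>z\<close> lies on \<open>e\<close> and within 1/2 of the
    integer \<open>h w\<close>, so \<open>h w\<close> is weakly between the end ranks; it differs
    from both because \<open>w\<close> is not an end of \<open>e\<close>.\<close>
  moreover have "h u \<noteq> h w" "h v \<noteq> h w"
    using inj_h wV uv assms(4) by (auto dest!: inj_onD)
  then have "h u < h w" "h w < h v" using ze assms(5) by linarith+
  ultimately show ?thesis
    using assms e1 wV uv(1) by (auto simp: crosses_at_def passed_def)
qed

lemma common_point_cases:
  assumes "e \<in> E" "f \<in> E" "e \<noteq> f"
    and z: "z \<in> path_image (curve e)" "z \<in> path_image (curve f)"
  obtains w where "w \<in> e" "w \<in> f" "z = point w"
  | w where "crosses_at e f w z"
  | w where "crosses_at f e w z"
proof -
  have neq: "x e \<noteq> x f" using inj_x assms by (auto dest: inj_onD)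
  have ze: "fst z = abscissa e (snd z)" and zf: "fst z = abscissa f (snd z)"
    using z by (auto simp: path_image_def curve_def)
  show thesis
  proof (cases "\<exists>w\<in>V. \<bar>snd z - h w\<bar> < 1/2")
    case False
    then have "abscissa e (snd z) = x e" "abscissa f (snd z) = x f"
      using abscissa_far assms by (meson not_le)+
    then show ?thesis using neq ze zf by simp
  next
    case True
    then obtain w where w: "w \<in> V" "\<bar>snd z - h w\<bar> < 1/2" by auto
    note ae = abscissa_near[OF assms(1) w] and af = abscissa_near[OF assms(2) w]
    consider "w \<notin> e" "w \<notin> f" | "w \<in> e" "w \<in> f" | "w \<in> f" "w \<notin> e" | "w \<in> e" "w \<notin> f" by blast
    then show ?thesis
    proof cases
      case 1
      then show ?thesis using ae af neq ze zf by simp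
    next
      case 2
      \<comment> \<open>Both abscissae are means with the same weight, so their difference is the
        vertical distance \<open>x e - x f\<close> scaled by one minus that weight.\<close>
      have "(x e - x f) * (1 - tent (snd z - h w)) = 0"
        using ae af ze zf 2 by (simp add: algebra_simps)
      then have "tent (snd z - h w) = 1" using neq by simp
      then have "snd z = h w" by (simp add: tent_eq_1_iff)
      then have "z = point w"
        using ze abscissa_vertex[OF assms(1) 2(1)] by (simp add: point_def prod_eq_iff)
      then show ?thesis using that 2 by blast
    next
      case 3
      then show ?thesis using that near_bar_crosses_at assms w by blast
    next
      case 4
      then show ?thesis using that near_bar_crosses_at assms w by blast
    qed
  qed
qed

lemma crosses_at_bar_unique:
  "e \<in> E \<Longrightarrow> crosses_at e f w z \<Longrightarrow> crosses_at e g w' z' \<Longrightarrow> w = w'"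
  using passed_unique by (auto simp: crosses_at_def)

text \<open>The bar \<open>w\<close> is an end of \<open>f\<close>, so \<open>f\<close> stays on one
  side of its rank. There \<open>tent\<close> is injective where positive, so \<open>f\<close> meets
  the vertical line of \<open>e\<close> only once in this band.\<close>

lemma crosses_at_point_unique:
  assumes "e \<in> E" "f \<in> E" "crosses_at e f w z" "crosses_at e f w' z'"
  shows "z = z'"
proof -
  have [simp]: "w' = w" using crosses_at_bar_unique assms by blast
  note c = assms(3,4)[unfolded crosses_at_def]
  obtain u v where uv: "f = {u, v}" "h u < h v" using edgeE[OF assms(2)] by metis
  have wV: "w \<in> V" and lw: "l w < x f" using c edge x_inside assms(2) by blast+
  have zf: "fst z = abscissa f (snd z)" "fst z' = abscissa f (snd z')"
     "h u \<le> snd z" "snd z \<le> h v" "h u \<le> snd z'" "snd z' \<le> h v"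
    using c by (auto simp: path_image_curve[OF uv])
  have "x e = x f - (x f - l w) * tent (snd z - h w)"
       "x e = x f - (x f - l w) * tent (snd z' - h w)"
    using zf(1,2) abscissa_near[OF assms(2) wV, of "snd z"]
      abscissa_near[OF assms(2) wV, of "snd z'"] c by auto
  then have "(x f - l w) * tent (snd z - h w) = (x f - l w) * tent (snd z' - h w)" by linarith
  then have t: "tent (snd z - h w) = tent (snd z' - h w)" using lw by simp
  have p: "tent (snd z - h w) > 0" using c by (simp add: tent_pos)
  have "w = u \<or> w = v" using c uv by auto
  then have "snd z - h w = snd z' - h w"
    using tent_inj_nonneg[OF t p] tent_inj_nonpos[OF t p] zf by auto
  then show ?thesis using c by (simp add: prod_eq_iff)
qed

text \<open>A shared end \<open>u\<close> would make \<open>f\<close> the edge from \<open>u\<close>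
  to the passed bar \<open>w\<close>; \<open>passed_adjacent\<close> then places \<open>f\<close>
  left of \<open>e\<close>, whereas a crossing needs it on the right.\<close>

lemma crosses_at_not_adjacent:
  assumes "e \<in> E" "f \<in> E" "crosses_at e f w z" "u \<in> e"
  shows "u \<notin> f"
proof
  assume "u \<in> f"
  note c = assms(3)[unfolded crosses_at_def]
  have "u \<noteq> w" using c assms(4) by auto
  then have "f = {u, w}"
    using edge[OF assms(2)] c \<open>u \<in> f\<close> by (auto simp: card_2_iff)
  then have "x f < x e" using passed_adjacent assms(1,2,4) c by blast
  then show False using c by simp
qed

text \<open>A common vertex excludes every crossing, crossings in opposite roles contradict the
  order of \<open>x\<close>, and two common vertices would make the edges equal.\<close>

lemma common_point_unique:
  assumes "e \<in> E" "f \<in> E" "e \<noteq> f"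
    and "z \<in> path_image (curve e)" "z \<in> path_image (curve f)"
    and "z' \<in> path_image (curve e)" "z' \<in> path_image (curve f)"
  shows "z = z'"
proof -
  have asym: False if "crosses_at e f w a" "crosses_at f e w' b" for w w' a b
    using that by (auto simp: crosses_at_def)
  have vertices: "w = w'" if "w \<in> e" "w \<in> f" "w' \<in> e" "w' \<in> f" for w w'
    using that edge[OF assms(1)] edge[OF assms(2)] assms(3) by (auto simp: card_2_iff)
  note adj = crosses_at_not_adjacent[OF assms(1,2)] crosses_at_not_adjacent[OF assms(2,1)]
  show ?thesis
  proof (cases rule: common_point_cases[OF assms(1-5)])
    case 1
    then show ?thesis
      by (cases rule: common_point_cases[OF assms(1-3,6,7)]) (use vertices adj in blast)+
  next
    case 2
    then show ?thesis
      by (cases rule: common_point_cases[OF assms(1-3,6,7)])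
        (use adj asym crosses_at_point_unique[OF assms(1,2)] in blast)+
  next
    case 3
    then show ?thesis
      by (cases rule: common_point_cases[OF assms(1-3,6,7)])
        (use adj asym crosses_at_point_unique[OF assms(2,1)] in blast)+
  qed
qed

lemma topological_drawing_curve: "topological_drawing V E point curve"
proof -
  have "inj_on point V" using inj_h by (auto simp: inj_on_def point_def)
  moreover have "\<exists>z. path_image (curve e) \<inter> path_image (curve f) \<subseteq> {z}"
    if "e \<in> E" "f \<in> E" "e \<noteq> f" for e f
    using common_point_unique[OF that] by blast
  ultimately show ?thesis
    unfolding topological_drawing_def using arc_curve endpoints_curve curve_avoids by blast
qed

lemma edges_crossE:
  assumes "e \<in> E" "f \<in> E" "e \<noteq> f" "edges_cross point curve e f"
  obtains w z where "crosses_at e f w z" | w z where "crosses_at f e w z"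
proof -
  obtain z where z: "z \<in> path_image (curve e)" "z \<in> path_image (curve f)"
    "z \<notin> point ` e" "z \<notin> point ` f"
    using assms by (auto simp: edges_cross_def)
  show thesis
    by (cases rule: common_point_cases[OF assms(1-3) z(1,2)]) (use that z in auto)
qed

lemma leftmost_edge_crosses_at:
  assumes "e \<in> E" "f \<in> E" "x e < x f" "edges_cross point curve e f"
  obtains w z where "crosses_at e f w z"
proof -
  have "e \<noteq> f" using assms(3) by auto
  moreover have "\<not> crosses_at f e w z" for w z using assms(3) by (auto simp: crosses_at_def)
  ultimately show thesis using edges_crossE[OF assms(1,2) _ assms(4)] that by metis
qed

text \<open>\<open>e\<close> passes only one bar, so that bar is an end of both \<open>f\<close> and
  \<open>g\<close>; adjacent edges do not cross.\<close>

lemma no_leftmost_of_crossing_triple: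
  assumes E: "e \<in> E" "f \<in> E" "g \<in> E" and "f \<noteq> g"
    and cross: "edges_cross point curve e f" "edges_cross point curve e g"
      "edges_cross point curve f g"
    and less: "x e < x f" "x e < x g"
  shows False
proof -
  obtain w z where c: "crosses_at e f w z"
    using leftmost_edge_crosses_at[OF E(1,2) less(1) cross(1)] .
  obtain w' z' where c': "crosses_at e g w' z'"
    using leftmost_edge_crosses_at[OF E(1,3) less(2) cross(2)] .
  have w: "w \<in> f" "w \<in> g"
    using crosses_at_bar_unique[OF E(1) c c'] c c' by (auto simp: crosses_at_def)
  show False
    by (rule edges_crossE[OF E(2,3) \<open>f \<noteq> g\<close> cross(3)]) (use crosses_at_not_adjacent E w in blast)+
qed

lemma quasi_planar: "quasi_planar V E"
proof -
  have False
    if E: "e \<in> E" "f \<in> E" "g \<in> E" and neq: "e \<noteq> f" "f \<noteq> g" "e \<noteq> g"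
      and cr: "edges_cross point curve e f" "edges_cross point curve f g"
        "edges_cross point curve e g" for e f g
  proof -
    have rc: "edges_cross point curve f e" "edges_cross point curve g f"
      "edges_cross point curve g e"
      using cr by (auto simp: edges_cross_def)
    have "x e \<noteq> x f" "x f \<noteq> x g" "x e \<noteq> x g"
      using inj_x E neq by (auto dest: inj_onD)
    then consider "x e < x f" "x e < x g" | "x f < x e" "x f < x g" | "x g < x e" "x g < x f"
      by linarith
    then show False
      using no_leftmost_of_crossing_triple[OF E(1,2,3)] no_leftmost_of_crossing_triple[OF E(2,1,3)]
        no_leftmost_of_crossing_triple[OF E(3,1,2)] neq cr rc by cases simp_all
  qed
  then show ?thesis
    unfolding quasi_planar_def using topological_drawing_curve by blast
qed

end

section \<open>Choosing the abscissae of the edges\<close>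

lemma finite_rank:
  fixes y :: "'a \<Rightarrow> real"
  assumes "finite V"
  obtains h :: "'a \<Rightarrow> nat" where "inj_on h V"
    "\<And>u v. u \<in> V \<Longrightarrow> v \<in> V \<Longrightarrow> y u < y v \<Longrightarrow> h u < h v"
proof -
  obtain ys where ys: "set ys = V" "distinct ys" using finite_distinct_list[OF assms] by blast
  \<comment> \<open>Positions in a sorted list without repetitions serve as ranks; equal keys still
    get different positions, which breaks ties.\<close>
  define xs where "xs = sort_key y ys"
  have xs: "set xs = V" "distinct xs" "sorted (map y xs)" using ys by (auto simp: xs_def)
  define h where "h = inv_into {..<length xs} (nth xs)"
  have img: "nth xs ` {..<length xs} = V" using xs by (auto simp: set_conv_nth)
  have h: "h v < length xs" "xs ! h v = v" if "v \<in> V" for v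
    using inv_into_into[of v "nth xs" "{..<length xs}"] f_inv_into_f[of v "nth xs" "{..<length xs}"]
      that img by (auto simp: h_def)
  have "inj_on h V" by (metis h(2) inj_onI)
  moreover have "h u < h v" if "u \<in> V" "v \<in> V" "y u < y v" for u v
  proof (rule ccontr)
    assume "\<not> h u < h v"
    then have "map y xs ! h v \<le> map y xs ! h u"
      using sorted_nth_mono[OF xs(3), of "h v" "h u"] h that by simp
    then show False using h that by simp
  qed
  ultimately show thesis using that by blast
qed

lemma finite_real_separation:
  fixes X :: "real set"
  assumes "finite X"
  obtains d where "d > 0" "\<And>s t. s \<in> X \<Longrightarrow> t \<in> X \<Longrightarrow> s < t \<Longrightarrow> s + d \<le> t"
proof -
  \<comment> \<open>The extra element 1 makes \<open>Min D\<close> meaningful when \<open>X\<close>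
    has fewer than two points.\<close>
  define D where "D = insert 1 ((\<lambda>(s, t). t - s) ` {(s, t). s \<in> X \<and> t \<in> X \<and> s < t})"
  have "{(s, t). s \<in> X \<and> t \<in> X \<and> s < t} \<subseteq> X \<times> X" by auto
  then have "finite {(s, t). s \<in> X \<and> t \<in> X \<and> s < t}"
    using assms by (meson finite_SigmaI finite_subset)
  then have fin: "finite D" unfolding D_def by (intro finite.insertI finite_imageI)
  then have "Min D > 0" by (subst Min_gr_iff) (auto simp: D_def)
  moreover have "s + Min D \<le> t" if "s \<in> X" "t \<in> X" "s < t" for s t
  proof -
    have "t - s \<in> D" using that by (force simp: D_def)
    then show ?thesis using Min_le[OF fin] by fastforce
  qed
  ultimately show thesis using that by blast
qed

text \<open>Each edge is put just to the right of \<open>t e\<close>, the leftmost bar end at which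
  it is visible. Shifts smaller than the least gap between bar ends preserve visibility and separate
  edges with the same \<open>t e\<close>; those passing no bar come first, as
  \<open>passed_adjacent\<close> demands.\<close>

lemma ex_edge_abscissae:
  fixes V :: "'a set" and E :: "'a set set" and h :: "'a \<Rightarrow> nat" and l r :: "'a \<Rightarrow> real"
  assumes fin: "finite V" and edge: "\<And>e. e \<in> E \<Longrightarrow> e \<subseteq> V \<and> card e = 2"
    and inj_h: "inj_on h V"
    and visible: "\<And>e. e \<in> E \<Longrightarrow> \<exists>a. (\<forall>w\<in>e. l w \<le> a \<and> a < r w) \<and>
      (\<forall>w\<in>passed V h l r e a. \<forall>w'\<in>passed V h l r e a. w = w')"
  obtains x where "ranked_layout V E h l r x"
proof -
  define X where "X = l ` V \<union> r ` V"
  have finX: "finite X" using fin by (simp add: X_def)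
  obtain d where d: "d > 0" "\<And>s t. s \<in> X \<Longrightarrow> t \<in> X \<Longrightarrow> s < t \<Longrightarrow> s + d \<le> t"
    using finite_real_separation[OF finX] by blast
  define vis where "vis e a \<longleftrightarrow> (\<forall>w\<in>e. l w \<le> a \<and> a < r w) \<and>
      (\<forall>w\<in>passed V h l r e a. \<forall>w'\<in>passed V h l r e a. w = w')" for e a
  define T where "T e = {t \<in> X. vis e t}" for e
  define t where "t e = Min (T e)" for e
  have finT: "finite (T e)" for e using finX by (simp add: T_def)
  \<comment> \<open>Membership in a half-open bar can change only at a bar end, and none lies after
    \<open>s\<close> up to \<open>a\<close>.\<close>
  have same: "(l w \<le> a \<and> a < r w) = (l w \<le> s \<and> s < r w)"
    if "w \<in> V" "s \<le> a" "\<And>q. q \<in> X \<Longrightarrow> \<not> (s < q \<and> q \<le> a)" for s a w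
  proof -
    have "l w \<in> X" "r w \<in> X" using that by (auto simp: X_def)
    then show ?thesis using that(2) that(3)[of "l w"] that(3)[of "r w"] by linarith
  qed
  have same_passed: "passed V h l r e a = passed V h l r e s"
    if "s \<le> a" "\<And>q. q \<in> X \<Longrightarrow> \<not> (s < q \<and> q \<le> a)" for s a e
  proof -
    have "(l w \<le> a \<and> a < r w) = (l w \<le> s \<and> s < r w)" if "w \<in> V" for w
      by (rule same) (use that \<open>s \<le> a\<close> \<open>\<And>q. q \<in> X \<Longrightarrow> \<not> (s < q \<and> q \<le> a)\<close> in blast)+
    then show ?thesis unfolding passed_def by blast
  qed
  have T_ne: "T e \<noteq> {}" if e: "e \<in> E" for e
  proof -
    have "\<exists>a. vis e a" using visible[OF e] by (simp only: vis_def)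
    then obtain a where a: "vis e a" ..
    have "e \<noteq> {}" using edge[OF e] by auto
    then obtain w where w: "w \<in> e" "w \<in> V" using edge[OF e] by blast
    \<comment> \<open>\<open>Max A\<close> is the last bar end at or before \<open>a\<close>; the
      left end of any end bar of \<open>e\<close> shows that it exists.\<close>
    define A where "A = {q \<in> X. q \<le> a}"
    have A: "finite A" "l w \<in> A" using finX a w by (auto simp: A_def X_def vis_def)
    then have m: "Max A \<in> A" by (intro Max_in) auto
    have n: "\<not> (Max A < q \<and> q \<le> a)" if "q \<in> X" for q
      using Max_ge[OF A(1), of q] that by (auto simp: A_def)
    have le: "Max A \<le> a" using m by (simp add: A_def)
    have "l q \<le> Max A \<and> Max A < r q" if q: "q \<in> e" for q
    proof -
      have "q \<in> V" using q edge[OF e] by blast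
      from same[OF this le n] show ?thesis using a q unfolding vis_def by blast
    qed
    then have "vis e (Max A)"
      using a same_passed[OF le n, of e] by (simp add: vis_def)
    then show ?thesis using m by (auto simp: T_def A_def)
  qed
  have t_in: "t e \<in> X" "vis e (t e)" if "e \<in> E" for e
    using Min_in[OF finT T_ne[OF that]] by (auto simp: t_def T_def)
  have "finite E" using fin edge by (meson Pow_iff finite_Pow_iff finite_subset subsetI)
  \<comment> \<open>Edges passing no bar at \<open>t e\<close> are ranked before those that pass
    one.\<close>
  then obtain k where k: "inj_on k E" "\<And>e f. e \<in> E \<Longrightarrow> f \<in> E \<Longrightarrow>
      (if passed V h l r e (t e) = {} then 0 else 1 :: real) <
      (if passed V h l r f (t f) = {} then 0 else 1) \<Longrightarrow> k e < (k f :: nat)"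
    using finite_rank[of E "\<lambda>e. if passed V h l r e (t e) = {} then 0 else 1"] by blast
  \<comment> \<open>An increasing function of the rank with values strictly between 0 and 1; adding
    2 rather than 1 keeps it positive at rank 0.\<close>
  define \<rho> where "\<rho> e = 1 - 1 / (real (k e) + 2)" for e
  have \<rho>: "0 < \<rho> e" "\<rho> e < 1" for e by (auto simp: \<rho>_def field_simps)
  have \<rho>_less: "\<rho> e < \<rho> f" if "k e < k f" for e f
    using that by (auto simp: \<rho>_def field_simps)
  define x where "x e = t e + d * \<rho> e" for e
  have x_t: "t e < x e" "x e < t e + d" for e using \<rho>[of e] d by (auto simp: x_def)
  have free: "\<not> (t e < q \<and> q \<le> x e)" if "e \<in> E" "q \<in> X" for e q
    using d(2)[OF t_in(1)[OF that(1)] that(2)] x_t[of e] by linarith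
  have x_same: "l w \<le> x e \<and> x e < r w \<longleftrightarrow> l w \<le> t e \<and> t e < r w" if "e \<in> E" "w \<in> V" for e w
    using same[OF that(2) less_imp_le[OF x_t(1)] free[OF that(1)]] .
  have x_passed: "passed V h l r e (x e) = passed V h l r e (t e)" if "e \<in> E" for e
    using same_passed[OF less_imp_le[OF x_t(1)] free[OF that(1)]] .
  have x_mono: "x e < x f" if "e \<in> E" "f \<in> E" "t e < t f" for e f
    using d(2)[OF t_in(1) t_in(1) that(3)] that x_t(2)[of e] x_t(1)[of f] by linarith
  show thesis
  proof (rule that, unfold_locales)
    show "e \<subseteq> V \<and> card e = 2" if "e \<in> E" for e using edge that by blast
    show "inj_on h V" by fact
    show "inj_on x E"
    proof (rule inj_onI)
      fix e f assume ef: "e \<in> E" "f \<in> E" "x e = x f"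
      then have "t e = t f" using x_mono[of e f] x_mono[of f e] by linarith
      then have "\<rho> e = \<rho> f" using ef d by (simp add: x_def)
      then have "k e = k f" using \<rho>_less[of e f] \<rho>_less[of f e] by linarith
      then show "e = f" using k ef by (auto dest: inj_onD)
    qed
    show generic: "x e \<noteq> l w" if "e \<in> E" "w \<in> V" for e w
      using free[OF that(1), of "l w"] x_t[of e] that by (auto simp: X_def)
    show "l w < x e \<and> x e < r w" if "e \<in> E" "w \<in> e" for e w
    proof -
      have "w \<in> V" using that edge[OF that(1)] by blast
      moreover have "l w \<le> t e \<and> t e < r w"
        using t_in(2)[OF that(1)] that(2) unfolding vis_def by blast
      ultimately have "l w \<le> x e \<and> x e < r w" using x_same[OF that(1)] by simp
      then show ?thesis using generic[OF that(1) \<open>w \<in> V\<close>] by simp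
    qed
    show "w = w'" if "e \<in> E" "w \<in> passed V h l r e (x e)" "w' \<in> passed V h l r e (x e)" for e w w'
      using that t_in(2)[OF that(1)] unfolding x_passed[OF that(1)] vis_def by blast
    show "x f < x e"
      if ef: "e \<in> E" "f \<in> E" and w: "w \<in> passed V h l r e (x e)" and u: "u \<in> e"
        and f: "f = {u, w}" for e f w u
    proof -
      have w': "w \<in> passed V h l r e (t e)" using w x_passed ef by simp
      have vise: "vis e (t e)" using t_in ef by blast
      \<comment> \<open>A bar strictly between \<open>u\<close> and \<open>w\<close> at
        \<open>t e\<close> is also passed by \<open>e\<close>, hence equals \<open>w\<close>, which
        is impossible.\<close>
      have empty: "passed V h l r f (t e) = {}"
      proof -
        have "q = w" if "q \<in> passed V h l r f (t e)" for q
        proof -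
          have "q \<in> passed V h l r e (t e)"
            using that w' u unfolding f passed_def by (auto intro: less_trans)
          then show ?thesis using w' vise by (auto simp: vis_def)
        qed
        moreover have "w \<notin> passed V h l r f (t e)"
          unfolding f passed_def by auto
        ultimately show ?thesis by blast
      qed
      have "\<forall>q\<in>f. l q \<le> t e \<and> t e < r q"
        using vise u w' by (auto simp: f vis_def passed_def)
      \<comment> \<open>So \<open>t e\<close> is a candidate position for \<open>f\<close>, and
        minimality bounds \<open>t f\<close>. In case of equality the ranking \<open>k\<close>
        decides, since \<open>e\<close> passes \<open>w\<close> while \<open>f\<close> passes
        nothing.\<close>
      then have "t e \<in> T f" using empty t_in ef by (auto simp: T_def vis_def)
      then have "t f \<le> t e" using finT by (simp add: t_def)
      moreover have "x f < x e" if "t f = t e"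
      proof -
        have "passed V h l r e (t e) \<noteq> {}" using w' by blast
        then have "k f < k e" using k(2)[OF ef(2,1)] empty that by simp
        then show ?thesis using \<rho>_less d that by (simp add: x_def)
      qed
      ultimately show ?thesis using x_mono[OF ef(2,1)] by linarith
    qed
  qed
qed

section \<open>From bar layouts to ranked layouts\<close>

lemma horizontal_segment:
  fixes a b y :: real
  assumes "a \<le> b"
  shows "closed_segment (a, y) (b, y) = {a..b} \<times> {y}"
proof -
  have "closed_segment (a, y) (b, y) = (\<lambda>s. (s, y)) ` closed_segment a b"
    by (auto simp: closed_segment_image_interval image_image algebra_simps)
  moreover have "closed_segment a b = {a..b}" using assms by (simp add: closed_segment_eq_real_ivl)
  ultimately show ?thesis by auto
qed

theorem theorem2:
  fixes V :: "'a set" and E :: "'a set set"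
  assumes "simple_graph V E"
    and "weak_bar1_visibility_graph V E"
  shows "quasi_planar V E"
proof -
  have edge: "e \<subseteq> V \<and> card e = 2" if "e \<in> E" for e
    using assms(1) that by (auto simp: simple_graph_def)
  have fin: "finite V" using assms(1) by (simp add: simple_graph_def)
  obtain B g where B: "bar_layout B" and g: "bij_betw g V B"
    and sub: "(\<lambda>e. g ` e) ` E \<subseteq> strong_bar1_edges B"
    using assms(2) by (auto simp: weak_bar1_visibility_graph_def graph_isomorphic_def)
  have gV: "g v \<in> B" if "v \<in> V" for v using g that by (auto simp: bij_betw_def)
  have g_inj: "g u = g v \<longleftrightarrow> u = v" if "u \<in> V" "v \<in> V" for u v
    using g that by (auto simp: bij_betw_def inj_on_def)
  have "\<forall>v\<in>V. \<exists>a b y. a < b \<and> g v = {a..b} \<times> {y}"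
    using gV B by (metis bar_def bar_layout_def horizontal_segment less_imp_le)
  then obtain l r y where lr: "\<And>v. v \<in> V \<Longrightarrow> l v < r v"
    and gv: "\<And>v. v \<in> V \<Longrightarrow> g v = {l v..r v} \<times> {y v}" by metis
  obtain h where h: "inj_on h V" "\<And>u v. u \<in> V \<Longrightarrow> v \<in> V \<Longrightarrow> y u < y v \<Longrightarrow> h u < (h v :: nat)"
    using finite_rank[OF fin] by blast
  have visible: "\<exists>a. (\<forall>w\<in>e. l w \<le> a \<and> a < r w) \<and>
      (\<forall>w\<in>passed V h l r e a. \<forall>w'\<in>passed V h l r e a. w = w')" if e: "e \<in> E" for e
  proof -
    obtain p q where pq: "g ` e = {p, q}" "one_visible B p q"
    proof -
      have "g ` e \<in> strong_bar1_edges B" using sub e by blast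
      then show thesis using that unfolding strong_bar1_edges_def by blast
    qed
    obtain a b c d where R: "a < b" "c < d"
      "{a..b} \<times> {c} \<subseteq> p \<and> {a..b} \<times> {d} \<subseteq> q \<or> {a..b} \<times> {c} \<subseteq> q \<and> {a..b} \<times> {d} \<subseteq> p"
      and card: "card {w \<in> B - {p, q}. w \<inter> ({a..b} \<times> {c..d}) \<noteq> {}} \<le> 1"
      using pq(2) by (auto simp: one_visible_def)
    \<comment> \<open>The visibility rectangle may rest on either bar; \<open>p'\<close> names the
      lower one.\<close>
    obtain p' q' where pq': "p' \<in> e" "q' \<in> e" "{p, q} = {g p', g q'}"
      "{a..b} \<times> {c} \<subseteq> g p'" "{a..b} \<times> {d} \<subseteq> g q'"
    proof -
      have "p \<in> g ` e" "q \<in> g ` e" using pq by auto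
      then show thesis using R(3) that by (auto simp: insert_commute)
    qed
    have V: "p' \<in> V" "q' \<in> V" using pq' edge[OF e] by auto
    have "(a, c) \<in> g p'" "(b, c) \<in> g p'" "(a, d) \<in> g q'" "(b, d) \<in> g q'"
      using pq' R(1) by auto
    then have y: "y p' = c" "y q' = d" and lp: "l p' \<le> a" "b \<le> r p'" "l q' \<le> a" "b \<le> r q'"
      using gv V by auto
    have e_eq: "e = {p', q'}"
      using edge[OF e] pq' y R(2) by (auto simp: card_2_iff)
    have hpq: "h p' < h q'" using h(2) V y R(2) by simp
    define N where "N = {w \<in> B - {p, q}. w \<inter> ({a..b} \<times> {c..d}) \<noteq> {}}"
    have "finite N" using B by (simp add: N_def bar_layout_def)
    then have N1: "s = s'" if "s \<in> N" "s' \<in> N" for s s'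
      using card that unfolding N_def[symmetric] by (simp add: card_le_Suc0_iff_eq)
    \<comment> \<open>The left side \<open>a\<close> of the rectangle is the visibility witness. A
      bar of intermediate rank over \<open>a\<close> has its height in the closed range from
      \<open>c\<close> to \<open>d\<close>, even when ranks broke a tie, so it meets the rectangle
      and is counted in \<open>N\<close>.\<close>
    have inN: "w \<in> V \<and> g w \<in> N" if "w \<in> passed V h l r e a" for w
    proof -
      have w: "w \<in> V" "l w \<le> a" "a < r w" "h p' < h w" "h w < h q'"
        using that hpq by (auto simp: passed_def e_eq)
      have "y p' \<le> y w" "y w \<le> y q'"
        using h(2)[OF w(1) V(1)] h(2)[OF V(2) w(1)] w by (meson not_le less_asym)+
      then have "(a, y w) \<in> g w \<inter> ({a..b} \<times> {c..d})"
        using w gv y R(1) by auto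
      moreover have "g w \<noteq> p" "g w \<noteq> q"
        using w pq'(3) g_inj V by (auto simp: doubleton_eq_iff)
      ultimately show ?thesis using w gV by (auto simp: N_def)
    qed
    have "w = w'" if "w \<in> passed V h l r e a" "w' \<in> passed V h l r e a" for w w'
      using inN[OF that(1)] inN[OF that(2)] N1 g_inj by blast
    \<comment> \<open>The non-zero width of the rectangle places \<open>a\<close> strictly before
      the right ends, as half-open bars require.\<close>
    moreover have "\<forall>w\<in>e. l w \<le> a \<and> a < r w" using lp R(1) by (auto simp: e_eq)
    ultimately show ?thesis by blast
  qed
  obtain x where "ranked_layout V E h l r x"
    using ex_edge_abscissae[OF fin edge h(1) visible] by blast
  then show ?thesis by (rule ranked_layout.quasi_planar)
qed

end
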